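(* Let $D=(V(D),E(D),w)$ be a vertex-weighted oriented cycle such that $w(x)\geq 2$ for every vertex $x\in V(D)$. Then $\operatorname{depth}(I(D))=1$.
   Context: A vertex-weighted oriented graph is a triple $D=(V(D),E(D),w)$, where $V(D)=\{x_1,\dots,x_n\}$ is a finite vertex set, $E(D)$ is a set of ordered pairs of distinct vertices such that each pair of vertices is joined by at most one edge, in only one direction, and $w:V(D)\to\{1,2,\ldots\}$ is a weight function. An edge written $uv$ is directed from its starting point $u$ to its ending point $v$. An oriented cycle is a cycle graph (on $n\ge 3$ vertices) in which all edges are oriented clockwise or all are oriented counterclockwise; i.e. up to relabelling the vertices, $E(D)=\{x_1x_2,x_2x_3,\ldots,x_{n-1}x_n,x_nx_1\}$. Put $w_j=w(x_j)$. Let $k$ be a field and $S=k[x_1,\ldots,x_n]$ with the standard grading. The edge ideal of $D$ is the ideal $I(D)=(x_ix_j^{w_j}\mid x_ix_j\in E(D))\subset S$, where $x_ix_j\in E(D)$ is directed from $x_i$ to $x_j$. Here $\operatorname{depth}(I(D))$ is the depth of the ideal $I(D)$ regarded as a graded $S$-module, with respect to the maximal ideal $(x_1,\ldots,x_n)$. *)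

theory Defs
  imports Main "HOL-Library.Poly_Mapping" "HOL-Library.Extended_Nat" "HOL-Library.Cardinality"
begin

section \<open>Depth of a module\<close>

text \<open>Modules are those of the locale \<^locale>\<open>module\<close>, given by their scalar multiplication \<open>s\<close>.\<close>

text \<open>For a submodule \<open>M\<close> this is \<open>(F) M\<close>, where \<open>(F)\<close> is the ideal generated by \<open>F\<close>.\<close>

definition smult_set ::
    "('a::comm_ring_1 \<Rightarrow> 'b::ab_group_add \<Rightarrow> 'b) \<Rightarrow> 'a set \<Rightarrow> 'b set \<Rightarrow> 'b set"
  where "smult_set s F M = module.span s {s f m | f m. f \<in> F \<and> m \<in> M}"

text \<open>\<open>f\<^sub>1, \<dots>, f\<^sub>r\<close> is \<open>M\<close>-regular if each \<open>f\<^sub>i\<close> is a nonzerodivisor on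
  \<open>M / (f\<^sub>1, \<dots>, f\<^bsub>i-1\<^esub>) M\<close> and \<open>M \<noteq> (f\<^sub>1, \<dots>, f\<^sub>r) M\<close>; membership in the denominator stands for
  vanishing in the quotient. List positions are counted from 0.\<close>

definition regular_sequence ::
    "('a::comm_ring_1 \<Rightarrow> 'b::ab_group_add \<Rightarrow> 'b) \<Rightarrow> 'b set \<Rightarrow> 'a list \<Rightarrow> bool"
  where "regular_sequence s M fs \<longleftrightarrow>
    (\<forall>i < length fs. \<forall>m \<in> M.
        s (fs ! i) m \<in> smult_set s (set (take i fs)) M \<longrightarrow> m \<in> smult_set s (set (take i fs)) M) \<and>
    smult_set s (set fs) M \<noteq> M"

text \<open>The supremum of the lengths of the \<open>M\<close>-regular sequences in the ideal \<open>J\<close>. For the zero module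
  (no regular sequences at all) the value is 0, not the customary \<open>\<infinity>\<close>.\<close>

definition depth ::
    "('a::comm_ring_1 \<Rightarrow> 'b::ab_group_add \<Rightarrow> 'b) \<Rightarrow> 'a set \<Rightarrow> 'b set \<Rightarrow> enat"
  where "depth s J M = Sup {enat (length fs) | fs. set fs \<subseteq> J \<and> regular_sequence s M fs}"

section \<open>Polynomial rings and ideals\<close>

text \<open>The polynomial ring \<open>k[x\<^sub>v | v :: 'v]\<close>, with exponent vectors as finitely supported functions;
  the product of \<^theory>\<open>HOL-Library.Poly_Mapping\<close> is convolution.\<close>

type_synonym ('v, 'k) mpoly = "('v \<Rightarrow>\<^sub>0 nat) \<Rightarrow>\<^sub>0 'k"

definition Var :: "'v \<Rightarrow> ('v, 'k::comm_ring_1) mpoly"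
  where "Var v = Poly_Mapping.single (Poly_Mapping.single v 1) 1"

text \<open>A commutative ring is a module over itself, and its submodules are its ideals.\<close>

lemma module_ring_self: "module ((*) :: 'a::comm_ring_1 \<Rightarrow> 'a \<Rightarrow> 'a)"
  by unfold_locales (simp_all add: algebra_simps)

abbreviation ideal_gen :: "'a::comm_ring_1 set \<Rightarrow> 'a set"
  where "ideal_gen \<equiv> module.span (*)"

definition irrelevant_ideal :: "('v, 'k::comm_ring_1) mpoly set"
  where "irrelevant_ideal = ideal_gen (range Var)"

definition ideal_depth :: "('v, 'k::comm_ring_1) mpoly set \<Rightarrow> enat"
  where "ideal_depth I = depth (*) irrelevant_ideal I"

section \<open>Vertex-weighted oriented graphs\<close>

text \<open>The vertex set is the whole type \<open>'v\<close>, which is taken to be finite below, so that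
  \<open>('v, 'k) mpoly\<close> is exactly the polynomial ring on the vertices.\<close>

record 'v weighted_digraph =
  edges :: "('v \<times> 'v) set"
  weight :: "'v \<Rightarrow> nat"

definition weighted_oriented_graph :: "'v::finite weighted_digraph \<Rightarrow> bool"
  where "weighted_oriented_graph D \<longleftrightarrow>
    (\<forall>u v. (u, v) \<in> edges D \<longrightarrow> u \<noteq> v \<and> (v, u) \<notin> edges D) \<and> (\<forall>v. weight D v \<ge> 1)"

definition weighted_oriented_cycle :: "'v::finite weighted_digraph \<Rightarrow> bool"
  where "weighted_oriented_cycle D \<longleftrightarrow> weighted_oriented_graph D \<and> CARD('v) \<ge> 3 \<and>
    (\<exists>x :: nat \<Rightarrow> 'v. bij_betw x {..<CARD('v)} UNIV \<and>
       edges D = {(x i, x (Suc i mod CARD('v))) | i. i < CARD('v)})"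

definition edge_ideal :: "'v::finite weighted_digraph \<Rightarrow> ('v, 'k::comm_ring_1) mpoly set"
  where "edge_ideal D = ideal_gen {Var u * Var v ^ weight D v | u v. (u, v) \<in> edges D}"

end

theory Submission
  imports Defs
begin

text \<open>Let \<open>I\<close> be the edge ideal and \<open>\<mm>\<close> the ideal of the variables. The monomial
  \<open>u = \<Prod>\<^sub>v x\<^sub>v\<^bsup>w(v) - 1\<^esup>\<close> lies outside \<open>I\<close>, because each generator of \<open>I\<close> contains some
  \<open>x\<^sub>v\<^bsup>w(v)\<^esup>\<close>. It is carried into \<open>I\<close> by each variable: in a cycle every \<open>v\<close> has a predecessor \<open>p\<close>,
  the exponent of \<open>x\<^sub>p\<close> in \<open>u\<close> is positive since \<open>w(p) \<ge> 2\<close>, and so \<open>x\<^sub>p x\<^sub>v\<^bsup>w(v)\<^esup>\<close> divides \<open>x\<^sub>v u\<close>.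
  Thus \<open>u\<close> is a socle element of \<open>S/I\<close>, which has depth 0.

  That depth 0 for \<open>S/I\<close> leaves \<open>I\<close> with depth at most 1 is proved directly, without homological
  algebra (\<open>depth_ideal_le_1_if_socle\<close>): if \<open>f, g \<in> \<mm>\<close> and \<open>f \<noteq> 0\<close>, then \<open>f u \<in> I\<close> and
  \<open>g (f u) = f (g u) \<in> f I\<close> although \<open>f u \<notin> f I\<close>, so \<open>g\<close> is a zerodivisor on \<open>I / f I\<close>, and \<open>f, g\<close>
  cannot begin an \<open>I\<close>-regular sequence. Conversely, a variable \<open>x\<^sub>z\<close> is by itself
  an \<open>I\<close>-regular sequence: it is a nonzerodivisor, and \<open>x\<^sub>z I \<noteq> I\<close> because some generator of \<open>I\<close>
  does not involve \<open>x\<^sub>z\<close>.\<close>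

section \<open>Depth of ideals\<close>

interpretation ring_self: module "(*) :: 'a::comm_ring_1 \<Rightarrow> 'a \<Rightarrow> 'a"
  by (rule module_ring_self)

lemma smult_set_empty: "smult_set ((*) :: 'a::comm_ring_1 \<Rightarrow> 'a \<Rightarrow> 'a) {} I = {0}"
  by (simp add: smult_set_def)

lemma smult_set_singleton:
  fixes f :: "'a::comm_ring_1"
  assumes "ring_self.subspace I"
  shows "smult_set (*) {f} I = (*) f ` I"
proof -
  have "ring_self.subspace ((*) f ` I)"
  proof (rule ring_self.subspaceI)
    show "0 \<in> (*) f ` I"
      using ring_self.subspace_0[OF assms] by (rule rev_image_eqI) simp
  next
    fix a b assume "a \<in> (*) f ` I" "b \<in> (*) f ` I"
    then show "a + b \<in> (*) f ` I"
      using ring_self.subspace_add[OF assms] by (auto simp: distrib_left[symmetric])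
  next
    fix c a assume "a \<in> (*) f ` I"
    then obtain i where "i \<in> I" "a = f * i"
      by auto
    then show "c * a \<in> (*) f ` I"
      using ring_self.subspace_scale[OF assms]
      by (intro rev_image_eqI[of "c * i"]) (simp_all add: mult.left_commute)
  qed
  moreover have "{f' * m | f' m. f' \<in> {f} \<and> m \<in> I} = (*) f ` I"
    by auto
  ultimately show ?thesis
    by (simp add: smult_set_def ring_self.span_eq_iff)
qed

text \<open>If \<open>f, g \<in> J\<close> began an \<open>I\<close>-regular sequence, then \<open>g (f u) = f (g u) \<in> f I\<close> would force
  \<open>f u = f i\<close> with \<open>i \<in> I\<close>. To cancel \<open>f\<close> it is enough that \<open>f\<close> is a nonzerodivisor on \<open>I\<close>, once
  \<open>u - i\<close> has been moved into \<open>I\<close> by multiplication with the nonzerodivisor \<open>e\<close>; so the argument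
  applies to rings with zero divisors.\<close>

lemma depth_ideal_le_1_if_socle:
  fixes I J :: "'a::comm_ring_1 set"
  assumes I: "ring_self.subspace I"
    and e: "e \<in> I" "\<And>h. e * h = 0 \<Longrightarrow> h = 0"
    and u: "u \<notin> I" "\<And>f. f \<in> J \<Longrightarrow> f * u \<in> I"
  shows "depth (*) J I \<le> 1"
  unfolding depth_def
proof (rule Sup_least, clarify)
  fix fs :: "'a list"
  assume J: "set fs \<subseteq> J" and reg: "regular_sequence (*) I fs"
  have "length fs < 2"
  proof (rule ccontr)
    assume "\<not> length fs < 2"
    then obtain f g gs where fs: "fs = f # g # gs"
      by (cases fs; cases "tl fs") auto
    have regD: "\<And>i m. i < length fs \<Longrightarrow> m \<in> I \<Longrightarrow> fs ! i * m \<in> smult_set (*) (set (take i fs)) I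
        \<Longrightarrow> m \<in> smult_set (*) (set (take i fs)) I"
      using reg by (auto simp: regular_sequence_def)
    have f: "m = 0" if "m \<in> I" "f * m = 0" for m
      using regD[of 0 m] that by (simp add: fs smult_set_empty)
    have g: "m \<in> (*) f ` I" if "m \<in> I" "g * m \<in> (*) f ` I" for m
      using regD[of 1 m] that by (simp add: fs smult_set_singleton[OF I])
    have "f * u \<in> I" "g * u \<in> I"
      using J u(2) by (auto simp: fs)
    then have "f * u \<in> (*) f ` I"
      by (intro g[of "f * u"] rev_image_eqI[of "g * u"]) (simp_all add: mult.left_commute)
    then obtain i where i: "i \<in> I" "f * u = f * i"
      by auto
    have "(u - i) * e \<in> I"
      using ring_self.subspace_scale[OF I e(1)] .
    moreover have "f * ((u - i) * e) = 0"
      using i(2) by (simp add: mult.assoc[symmetric] right_diff_distrib)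
    ultimately have "(u - i) * e = 0"
      by (rule f)
    then have "u = i"
      using e(2)[of "u - i"] by (simp add: mult.commute)
    with i(1) u(1) show False
      by simp
  qed
  then show "enat (length fs) \<le> 1"
    by (simp add: one_enat_def)
qed

lemma depth_ge_1:
  fixes I J :: "'a::comm_ring_1 set"
  assumes "ring_self.subspace I" "f \<in> J" "\<And>m. f * m = 0 \<Longrightarrow> m = 0" "(*) f ` I \<noteq> I"
  shows "1 \<le> depth (*) J I"
proof -
  have "regular_sequence (*) I [f]"
    using assms by (auto simp: regular_sequence_def smult_set_empty smult_set_singleton)
  then have "enat (length [f]) \<le> depth (*) J I"
    unfolding depth_def using assms(2) by (intro Sup_upper) (auto intro!: exI[of _ "[f]"])
  then show ?thesis
    by (simp add: one_enat_def)
qed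

section \<open>Monomials and monomial ideals\<close>

lemma Var_power: "(Var v :: ('v, 'k::comm_ring_1) mpoly) ^ n =
    Poly_Mapping.single (Poly_Mapping.single v n) 1"
  by (induction n) (simp_all add: Var_def mult_single single_add[symmetric])

lemma edge_generator_eq_monomial: "(Var u * Var v ^ n :: ('v, 'k::comm_ring_1) mpoly) =
    Poly_Mapping.single (Poly_Mapping.single u 1 + Poly_Mapping.single v n) 1"
  by (simp only: Var_power) (simp add: Var_def mult_single)

lemma lookup_monomial_mult:
  fixes p :: "('v, 'k::comm_ring_1) mpoly"
  shows "Poly_Mapping.lookup (Poly_Mapping.single a 1 * p) (a + b) = Poly_Mapping.lookup p b"
  by (simp add: lookup_mult lookup_single when_mult)

lemma monomial_mult_eq_0D:
  fixes p :: "('v, 'k::comm_ring_1) mpoly"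
  assumes "Poly_Mapping.single a 1 * p = 0"
  shows "p = 0"
  by (rule poly_mapping_eqI) (metis assms lookup_monomial_mult lookup_zero)

text \<open>The upward closed sets of exponent vectors are the exponent sets of monomial ideals. This
  bounds an ideal by a monomial ideal that contains its generators.\<close>

lemma keys_subset_if_in_ideal_gen:
  fixes p :: "('v, 'k::comm_ring_1) mpoly"
  assumes "p \<in> ideal_gen G"
    and G: "\<And>q. q \<in> G \<Longrightarrow> Poly_Mapping.keys q \<subseteq> U"
    and U: "\<And>a b. b \<in> U \<Longrightarrow> a + b \<in> U"
  shows "Poly_Mapping.keys p \<subseteq> U"
  using assms(1)
proof (induction rule: ring_self.span_induct_alt)
  case base
  then show ?case by simp
next
  case (step c x y)
  have "Poly_Mapping.keys (c * x) \<subseteq> U"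
    using keys_mult[of c x] G[OF step(1)] U by blast
  then show ?case
    using step(2) keys_add[of "c * x" y] by blast
qed

lemma mult_mem_if_in_irrelevant_ideal:
  fixes u :: "('v, 'k::comm_ring_1) mpoly"
  assumes I: "ring_self.subspace I" and "\<And>v. Var v * u \<in> I" and "f \<in> irrelevant_ideal"
  shows "f * u \<in> I"
  using assms(3) unfolding irrelevant_ideal_def
proof (induction rule: ring_self.span_induct_alt)
  case base
  then show ?case using ring_self.subspace_0[OF I] by simp
next
  case (step c x y)
  then have "c * (x * u) \<in> I"
    using assms(2) by (intro ring_self.subspace_scale[OF I, of "x * u"]) auto
  from ring_self.subspace_add[OF I this step(2)] show ?case
    by (simp only: distrib_right mult.assoc)
qed

section \<open>Edge ideals\<close>

lemma edge_monomial_in_edge_ideal: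
  assumes "(u, v) \<in> edges D"
  shows "Poly_Mapping.single (Poly_Mapping.single u 1 + Poly_Mapping.single v (weight D v)) 1
    \<in> (edge_ideal D :: ('v::finite, 'k::comm_ring_1) mpoly set)"
  unfolding edge_ideal_def edge_generator_eq_monomial
  using assms by (intro ring_self.span_base) blast

lemma ex_weight_le_if_in_edge_ideal:
  fixes p :: "('v::finite, 'k::comm_ring_1) mpoly"
  assumes "p \<in> edge_ideal D" "a \<in> Poly_Mapping.keys p"
  shows "\<exists>v. weight D v \<le> Poly_Mapping.lookup a v"
proof -
  have "Poly_Mapping.keys p \<subseteq> {a. \<exists>v. weight D v \<le> Poly_Mapping.lookup a v}"
    using assms(1) unfolding edge_ideal_def edge_generator_eq_monomial
  proof (rule keys_subset_if_in_ideal_gen)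
    fix q :: "('v, 'k) mpoly"
    assume "q \<in> {Poly_Mapping.single (Poly_Mapping.single u 1 +
        Poly_Mapping.single v (weight D v)) 1 | u v. (u, v) \<in> edges D}"
    then obtain u v where "q = Poly_Mapping.single (Poly_Mapping.single u 1 +
        Poly_Mapping.single v (weight D v)) 1"
      by blast
    then show "Poly_Mapping.keys q \<subseteq> {a. \<exists>v. weight D v \<le> Poly_Mapping.lookup a v}"
      by (auto simp: lookup_add intro!: exI[of _ v])
  qed (auto simp: lookup_add intro: trans_le_add2)
  with assms(2) show ?thesis by blast
qed

text \<open>The exponent vector of \<open>\<Prod>\<^sub>v x\<^sub>v\<^bsup>w(v) - 1\<^esup>\<close>.\<close>

definition socle_exponent :: "'v::finite weighted_digraph \<Rightarrow> 'v \<Rightarrow>\<^sub>0 nat"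
  where "socle_exponent D = Poly_Mapping.Abs_poly_mapping (\<lambda>v. weight D v - 1)"

lemma lookup_socle_exponent: "Poly_Mapping.lookup (socle_exponent D) v = weight D v - 1"
  by (simp add: socle_exponent_def)

lemma socle_monomial_notin_edge_ideal:
  assumes "\<And>v. 1 \<le> weight D v"
  shows "Poly_Mapping.single (socle_exponent D) 1
    \<notin> (edge_ideal D :: ('v::finite, 'k::comm_ring_1) mpoly set)"
proof
  assume "Poly_Mapping.single (socle_exponent D) 1 \<in> (edge_ideal D :: ('v, 'k) mpoly set)"
  then obtain v where "weight D v \<le> weight D v - 1"
    using ex_weight_le_if_in_edge_ideal[of _ D "socle_exponent D"]
    by (fastforce simp: lookup_socle_exponent)
  with assms[of v] show False by simp
qed

text \<open>The monomial of the edge \<open>(p, v)\<close> divides \<open>x\<^sub>v u\<close>, where \<open>u = \<Prod>\<^sub>z x\<^sub>z\<^bsup>w(z) - 1\<^esup>\<close>: the extra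
  factor completes \<open>x\<^sub>v\<^bsup>w(v)\<^esup>\<close>, and \<open>w(p) \<ge> 2\<close> leaves at least one factor \<open>x\<^sub>p\<close> in \<open>u\<close>.\<close>

lemma Var_mult_socle_monomial_in_edge_ideal:
  assumes "(p, v) \<in> edges D" "p \<noteq> v" "2 \<le> weight D p" "1 \<le> weight D v"
  shows "Var v * Poly_Mapping.single (socle_exponent D) 1
    \<in> (edge_ideal D :: ('v::finite, 'k::comm_ring_1) mpoly set)"
proof -
  let ?a = "Poly_Mapping.single p 1 + Poly_Mapping.single v (weight D v)"
  let ?b = "Poly_Mapping.single v 1 + socle_exponent D"
  have "?b = (?b - ?a) + ?a"
    using assms(2-4)
    by (intro poly_mapping_eqI)
      (auto simp: lookup_add lookup_minus lookup_single lookup_socle_exponent when_def)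
  then have "Var v * Poly_Mapping.single (socle_exponent D) 1
      = Poly_Mapping.single (?b - ?a) 1 * (Poly_Mapping.single ?a 1 :: ('v, 'k) mpoly)"
    by (simp add: Var_def mult_single)
  then show ?thesis
    using ring_self.span_scale[of _ "{Var u * Var v ^ weight D v | u v. (u, v) \<in> edges D}"]
      edge_monomial_in_edge_ideal[OF assms(1)]
    by (simp add: edge_ideal_def)
qed

lemma Var_mult_edge_ideal_neq:
  assumes "(u, v) \<in> edges D" "z \<noteq> u" "z \<noteq> v"
  shows "(*) (Var z) ` edge_ideal D \<noteq> (edge_ideal D :: ('v::finite, 'k::comm_ring_1) mpoly set)"
proof
  let ?a = "Poly_Mapping.single u 1 + Poly_Mapping.single v (weight D v)"
  assume "(*) (Var z) ` edge_ideal D = (edge_ideal D :: ('v, 'k) mpoly set)"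
  then obtain q :: "('v, 'k) mpoly" where q: "Poly_Mapping.single ?a 1 = Var z * q"
    using edge_monomial_in_edge_ideal[OF assms(1)] by blast
  have "?a \<in> Poly_Mapping.keys (Var z * q)"
    unfolding q[symmetric] by simp
  then obtain b where "?a = Poly_Mapping.single z 1 + b"
    using keys_mult[of "Var z" q] by (auto simp: Var_def)
  then have "Poly_Mapping.lookup ?a z = Poly_Mapping.lookup (Poly_Mapping.single z 1 + b) z"
    by simp
  with assms(2,3) show False
    by (simp add: lookup_add lookup_single)
qed

section \<open>Oriented cycles\<close>

lemma weighted_oriented_cycle_ex_predecessor:
  assumes "weighted_oriented_cycle D"
  shows "\<exists>p. (p, v) \<in> edges D"
proof -
  let ?n = "CARD('a)"
  obtain x where x: "bij_betw x {..<?n} UNIV" "edges D = {(x i, x (Suc i mod ?n)) | i. i < ?n}"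
    using assms by (auto simp: weighted_oriented_cycle_def)
  obtain j where j: "j < ?n" "v = x j"
    using x(1) by (auto simp: bij_betw_def)
  have "Suc ((j + ?n - 1) mod ?n) mod ?n = j"
    using j(1) by (simp add: mod_Suc_eq)
  then have "(x ((j + ?n - 1) mod ?n), v) \<in> edges D"
    unfolding x(2) j(2) using j(1) by fastforce
  then show ?thesis ..
qed

theorem corollary4p2:
  fixes D :: "'v::finite weighted_digraph"
  assumes "weighted_oriented_cycle D"
    and "\<forall>x. weight D x \<ge> 2"
  shows "ideal_depth (edge_ideal D :: ('v, 'k::field) mpoly set) = 1"
proof -
  let ?I = "edge_ideal D :: ('v, 'k) mpoly set"
  have I: "ring_self.subspace ?I"
    by (simp add: edge_ideal_def)
  have w1: "1 \<le> weight D v" for v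
    using assms(2)[rule_format, of v] by simp
  have no_loop: "u \<noteq> v" if "(u, v) \<in> edges D" for u v
    using assms(1) that by (auto simp: weighted_oriented_cycle_def weighted_oriented_graph_def)
  obtain u v where uv: "(u, v) \<in> edges D"
    using weighted_oriented_cycle_ex_predecessor[OF assms(1)] by blast
  let ?e = "Poly_Mapping.single (Poly_Mapping.single u 1 + Poly_Mapping.single v (weight D v)) 1
    :: ('v, 'k) mpoly"
  have "depth (*) irrelevant_ideal ?I \<le> 1"
  proof (rule depth_ideal_le_1_if_socle[OF I])
    show "?e \<in> ?I"
      by (rule edge_monomial_in_edge_ideal[OF uv])
    show "h = 0" if "?e * h = 0" for h
      using that by (rule monomial_mult_eq_0D)
    show "Poly_Mapping.single (socle_exponent D) 1 \<notin> ?I"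
      by (rule socle_monomial_notin_edge_ideal[OF w1])
    have "Var z * Poly_Mapping.single (socle_exponent D) 1 \<in> ?I" for z
      using weighted_oriented_cycle_ex_predecessor[OF assms(1), of z] no_loop assms(2) w1
      by (blast intro: Var_mult_socle_monomial_in_edge_ideal)
    then show "f * Poly_Mapping.single (socle_exponent D) 1 \<in> ?I" if "f \<in> irrelevant_ideal" for f
      using that by (rule mult_mem_if_in_irrelevant_ideal[OF I])
  qed
  moreover have "1 \<le> depth (*) irrelevant_ideal ?I"
  proof -
    have "card {u, v} < CARD('v)"
      using assms(1) by (auto simp: weighted_oriented_cycle_def card_insert_if)
    then have "{u, v} \<noteq> UNIV"
      by auto
    then obtain z where z: "z \<noteq> u" "z \<noteq> v"
      by blast
    show ?thesis
    proof (rule depth_ge_1[OF I])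
      show "Var z \<in> (irrelevant_ideal :: ('v, 'k) mpoly set)"
        unfolding irrelevant_ideal_def by (intro ring_self.span_base) simp
      show "m = 0" if "Var z * m = 0" for m :: "('v, 'k) mpoly"
        using that unfolding Var_def by (rule monomial_mult_eq_0D)
      show "(*) (Var z) ` ?I \<noteq> ?I"
        by (rule Var_mult_edge_ideal_neq[OF uv z])
    qed
  qed
  ultimately show ?thesis
    unfolding ideal_depth_def by (rule antisym)
qed

end
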